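(* Let $R$ be a super Dedekind complete and weakly $\sigma$-distributive lattice group, $G$ an infinite set, $\mathcal{L}$ an algebra of subsets of $G$ satisfying property $(E)$, and $m_j:\mathcal{L}\to R$, $j\in\mathbb{N}$, a sequence of equibounded, positive and $(s)$-bounded set functions. Then for every disjoint sequence $(C_h)_h$ in $\mathcal{L}$ there is a subsequence $(C_{n_h})_h$ such that every $m_j$ is continuous from above at $\emptyset$ on the $\sigma$-algebra generated by $(C_{n_h})_h$ in the set $\bigcup_{h=1}^\infty C_{n_h}$ (this $\sigma$-algebra being contained in $\mathcal{L}$).
   Context: A lattice group is Dedekind complete if every nonempty subset bounded from above has a supremum; it is super Dedekind complete if moreover every nonempty $A\subset R$ bounded from above has a countable subset $A'$ with $\bigvee A'=\bigvee A$. A sequence $(\sigma_p)_p$ in $R$ is an $(O)$-sequence if it is decreasing and $\bigwedge_p\sigma_p=0$. A bounded double sequence $(a_{t,l})_{t,l}$ in $R$ is a $(D)$-sequence (or regulator) if $(a_{t,l})_l$ is an $(O)$-sequence for every $t\in\mathbb{N}$. $R$ is weakly $\sigma$-distributive if $\bigwedge_{\varphi\in\mathbb{N}^{\mathbb{N}}}\bigl(\bigvee_{t=1}^\infty a_{t,\varphi(t)}\bigr)=0$ for every $(D)$-sequence $(a_{t,l})_{t,l}$ in $R$. $(D)\lim_n x_n=x$ with respect to a regulator $(a_{t,l})_{t,l}$ means: for every $\varphi\in\mathbb{N}^{\mathbb{N}}$ there is $n_0$ with $|x_n-x|\le\bigvee_{t=1}^\infty a_{t,\varphi(t)}$ for all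 $n\ge n_0$. Property $(E)$: every disjoint sequence $(C_h)_h$ in $\mathcal{L}$ has a subsequence $(C_{h_r})_r$ such that $\mathcal{L}$ contains the $\sigma$-algebra generated by the sets $C_{h_r}$, $r\in\mathbb{N}$, in the set $\bigcup_r C_{h_r}$. The $m_j$ are equibounded if there is $u\in R$ with $|m_j(A)|\le u$ for all $j\in\mathbb{N}$, $A\in\mathcal{L}$. A positive set function $m$ is $(s)$-bounded if there is a $(D)$-sequence with respect to which $(D)\lim_h m(C_h)=0$ for every disjoint sequence $(C_h)_h$ in $\mathcal{L}$ (for the $m_j$, the $(D)$-sequence may depend on $j$). $m$ is continuous from above at $\emptyset$ on a family $\mathcal{A}\subset\mathcal{L}$ if there is a $(D)$-sequence with respect to which $(D)\lim_n m(H_n)=0$ for every decreasing sequence $(H_n)_n$ in $\mathcal{A}$ with $\bigcap_n H_n=\emptyset$. *)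

theory Defs
  imports "HOL-Analysis.Sigma_Algebra" "HOL-Library.Lattice_Algebras"
begin

text \<open>The absolute value of \<^class>\<open>lattice_ab_group_add_abs\<close> is \<open>sup a (- a)\<close>. Lattice groups are
  taken to be abelian, which is no restriction, since Dedekind complete lattice groups are abelian.\<close>

class dedekind_complete_lattice_group =
  lattice_ab_group_add_abs + conditionally_complete_lattice

text \<open>\<open>Sup\<close> and \<open>Inf\<close> are unspecified on sets that are empty or unbounded; this is why
  \<open>A' \<noteq> {}\<close> and \<open>bdd_below\<close> are required explicitly below.\<close>

definition super_dedekind_complete :: "'r::dedekind_complete_lattice_group itself \<Rightarrow> bool" where
  "super_dedekind_complete _ \<longleftrightarrow>
    (\<forall>A :: 'r set. A \<noteq> {} \<and> bdd_above A \<longrightarrow>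
      (\<exists>A' \<subseteq> A. A' \<noteq> {} \<and> countable A' \<and> Sup A' = Sup A))"

definition O_sequence :: "(nat \<Rightarrow> 'r::dedekind_complete_lattice_group) \<Rightarrow> bool" where
  "O_sequence \<sigma> \<longleftrightarrow> decseq \<sigma> \<and> bdd_below (range \<sigma>) \<and> (INF p. \<sigma> p) = 0"

definition D_sequence :: "(nat \<Rightarrow> nat \<Rightarrow> 'r::dedekind_complete_lattice_group) \<Rightarrow> bool" where
  "D_sequence a \<longleftrightarrow> (\<exists>u. \<forall>t l. \<bar>a t l\<bar> \<le> u) \<and> (\<forall>t. O_sequence (a t))"

definition weakly_sigma_distributive :: "'r::dedekind_complete_lattice_group itself \<Rightarrow> bool" where
  "weakly_sigma_distributive _ \<longleftrightarrow>
    (\<forall>a :: nat \<Rightarrow> nat \<Rightarrow> 'r. D_sequence a \<longrightarrow> (INF \<phi> :: nat \<Rightarrow> nat. SUP t. a t (\<phi> t)) = 0)"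

definition D_lim ::
    "(nat \<Rightarrow> nat \<Rightarrow> 'r::dedekind_complete_lattice_group) \<Rightarrow> (nat \<Rightarrow> 'r) \<Rightarrow> 'r \<Rightarrow> bool" where
  "D_lim a x l \<longleftrightarrow>
    (\<forall>\<phi> :: nat \<Rightarrow> nat. \<exists>n0. \<forall>n\<ge>n0. \<bar>x n - l\<bar> \<le> (SUP t. a t (\<phi> t)))"

definition disjoint_sequence_in :: "'a set set \<Rightarrow> (nat \<Rightarrow> 'a set) \<Rightarrow> bool" where
  "disjoint_sequence_in L C \<longleftrightarrow> range C \<subseteq> L \<and> disjoint_family C"

definition property_E :: "'a set set \<Rightarrow> bool" where
  "property_E L \<longleftrightarrow>
    (\<forall>C. disjoint_sequence_in L C \<longrightarrow>
      (\<exists>r :: nat \<Rightarrow> nat. strict_mono r \<and>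
        sigma_sets (\<Union>i. C (r i)) (range (\<lambda>i. C (r i))) \<subseteq> L))"

definition positive_on ::
    "'a set set \<Rightarrow> ('a set \<Rightarrow> 'r::dedekind_complete_lattice_group) \<Rightarrow> bool" where
  "positive_on L m \<longleftrightarrow> (\<forall>A\<in>L. 0 \<le> m A)"

definition equibounded_on ::
    "'a set set \<Rightarrow> (nat \<Rightarrow> 'a set \<Rightarrow> 'r::dedekind_complete_lattice_group) \<Rightarrow> bool" where
  "equibounded_on L m \<longleftrightarrow> (\<exists>u. \<forall>j. \<forall>A\<in>L. \<bar>m j A\<bar> \<le> u)"

text \<open>A single regulator has to serve all disjoint sequences (and, for continuity from above, all
  decreasing sequences with empty intersection).\<close>

definition s_bounded_on ::
    "'a set set \<Rightarrow> ('a set \<Rightarrow> 'r::dedekind_complete_lattice_group) \<Rightarrow> bool" where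
  "s_bounded_on L m \<longleftrightarrow>
    (\<exists>a. D_sequence a \<and> (\<forall>C. disjoint_sequence_in L C \<longrightarrow> D_lim a (\<lambda>h. m (C h)) 0))"

definition continuous_from_above_at_empty_on ::
    "'a set set \<Rightarrow> ('a set \<Rightarrow> 'r::dedekind_complete_lattice_group) \<Rightarrow> bool" where
  "continuous_from_above_at_empty_on \<A> m \<longleftrightarrow>
    (\<exists>a. D_sequence a \<and>
      (\<forall>H. range H \<subseteq> \<A> \<and> decseq H \<and> (\<Inter>n. H n) = {} \<longrightarrow> D_lim a (\<lambda>n. m (H n)) 0))"

end

theory Submission
  imports Defs "HOL-Library.Diagonal_Subsequence"
begin

text \<open>Super Dedekind completeness and weak \<open>\<sigma>\<close>-distributivity together turn \<open>(D)\<close>-convergence with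
  respect to a regulator into order convergence controlled by a single \<open>(O)\<close>-sequence \<open>s\<close>: every
  \<open>s k\<close> is eventually an upper bound. Countably many conditions then describe \<open>(s)\<close>-boundedness of
  all the \<open>m j\<close>, and a diagonal argument can treat them one at a time.

  By property \<open>(E)\<close> one may pass to a subsequence all of whose unions lie in \<open>L\<close>. Fix \<open>j\<close> and
  \<open>k\<close>, and let \<open>s\<^sub>j\<close> be the \<open>(O)\<close>-sequence controlling \<open>m j\<close>. Every subsequence contains a further
  one all of whose unions have \<open>m j\<close>-value at most \<open>s\<^sub>j k\<close>: otherwise split the given subsequence
  into infinitely many disjoint subsequences; each of them has a union violating the bound, and
  these unions form a disjoint sequence that contradicts \<open>(s)\<close>-boundedness
  (\<open>s_bounded_bound_subsequence\<close>). The set functions need not be monotone, which is why the bound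
  is imposed on all unions at once; in this form it passes to subsequences, and diagonalising over
  the pairs \<open>(j, k)\<close> yields one subsequence for which, for every \<open>(j, k)\<close>, the bound holds on all
  unions of a tail.

  The generated \<open>\<sigma>\<close>-algebra consists of the unions of members of the subsequence. If \<open>H n\<close>
  decreases to the empty set in it, then \<open>H n\<close> eventually avoids any given finite set of
  members, and so becomes a union of a tail; hence \<open>m j (H n) \<le> s\<^sub>j k\<close> eventually.\<close>

section \<open>The \<open>\<sigma>\<close>-algebra generated by a disjoint sequence\<close>

lemma UN_in_sigma_sets_range:
  fixes C :: "nat \<Rightarrow> 'a set"
  shows "(\<Union>i\<in>I. C i) \<in> sigma_sets (\<Union>i. C i) (range C)"
proof (rule sigma_sets_UNION)
  show "countable (C ` I)" by simp
qed auto

lemma sigma_sets_disjoint_family_eq: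
  fixes C :: "nat \<Rightarrow> 'a set"
  assumes disj: "disjoint_family C"
  shows "sigma_sets (\<Union>i. C i) (range C) = range (\<lambda>I. \<Union>i\<in>I. C i)"
proof (intro equalityI subsetI)
  fix X assume "X \<in> sigma_sets (\<Union>i. C i) (range C)"
  then show "X \<in> range (\<lambda>I. \<Union>i\<in>I. C i)"
  proof induction
    case (Basic a)
    then obtain i where "a = (\<Union>i\<in>{i}. C i)" by auto
    then show ?case by blast
  next
    case Empty
    have "{} = (\<Union>i\<in>{}. C i)" by simp
    then show ?case by blast
  next
    case (Compl a)
    then obtain I where I: "a = (\<Union>i\<in>I. C i)" by blast
    have "i = k" if "x \<in> C i" "x \<in> C k" for x i k
      using disjoint_family_onD[OF disj, of i k] that by blast
    then have "(\<Union>i. C i) - a = (\<Union>i\<in>-I. C i)"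
      unfolding I by blast
    then show ?case by blast
  next
    case (Union a)
    then have "\<forall>n. \<exists>I. a n = (\<Union>i\<in>I. C i)" by blast
    then obtain I where "\<And>n. a n = (\<Union>i\<in>I n. C i)" by metis
    then have "(\<Union>n. a n) = (\<Union>i\<in>(\<Union>n. I n). C i)" by auto
    then show ?case by blast
  qed
next
  fix X assume "X \<in> range (\<lambda>I. \<Union>i\<in>I. C i)"
  then show "X \<in> sigma_sets (\<Union>i. C i) (range C)"
    using UN_in_sigma_sets_range by blast
qed

text \<open>Each \<open>C i\<close> is an atom of the generated \<open>\<sigma>\<close>-algebra (or empty): once \<open>H N\<close> misses one of its
  points, all later \<open>H n\<close> miss it entirely.\<close>

lemma decseq_to_empty_eventually_in_tail:
  fixes C :: "nat \<Rightarrow> 'a set" and p :: nat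
  assumes disj: "disjoint_family C"
    and ran: "range H \<subseteq> sigma_sets (\<Union>i. C i) (range C)"
    and dec: "decseq H"
    and empty: "(\<Inter>n. H n) = {}"
  shows "\<forall>\<^sub>F n in sequentially. \<exists>I. H n = (\<Union>i\<in>I. C (p + i))"
proof -
  have "\<forall>n. \<exists>I. H n = (\<Union>i\<in>I. C i)"
    using ran unfolding sigma_sets_disjoint_family_eq[OF disj] by blast
  then obtain J where J: "\<And>n. H n = (\<Union>i\<in>J n. C i)" by metis
  have "\<forall>\<^sub>F n in sequentially. C i \<inter> H n = {}" for i
  proof (cases "C i = {}")
    case False
    then obtain x where x: "x \<in> C i" by blast
    with empty obtain N where N: "x \<notin> H N" by blast
    have "C i \<inter> H n = {}" if "n \<ge> N" for n
    proof -
      have "x \<notin> H n" using N decseqD[OF dec that] by blast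
      then have "i \<notin> J n" using x J by blast
      then have "C i \<inter> C k = {}" if "k \<in> J n" for k
        using disjoint_family_onD[OF disj, of i k] that by blast
      then show ?thesis unfolding J by blast
    qed
    then show ?thesis by (auto simp: eventually_sequentially)
  qed simp
  then have "\<forall>\<^sub>F n in sequentially. \<forall>i\<in>{..<p}. C i \<inter> H n = {}"
    by (intro eventually_ball_finite) auto
  then show ?thesis
  proof eventually_elim
    case (elim n)
    have "H n = (\<Union>i\<in>{i. p + i \<in> J n}. C (p + i))"
    proof (intro equalityI subsetI)
      fix x assume "x \<in> H n"
      then obtain i where i: "i \<in> J n" "x \<in> C i" using J by blast
      with elim \<open>x \<in> H n\<close> have "i \<ge> p" by (meson disjoint_iff lessThan_iff not_le)
      then have "p + (i - p) = i" by simp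
      with i show "x \<in> (\<Union>i\<in>{i. p + i \<in> J n}. C (p + i))"
        by (metis (mono_tags, lifting) UN_I mem_Collect_eq)
    qed (auto simp: J)
    then show ?case by blast
  qed
qed

section \<open>From regulators to order convergence\<close>

text \<open>Mirror image under negation of the defining property, which speaks of suprema.\<close>

lemma super_dedekind_complete_Inf:
  fixes B :: "'r::dedekind_complete_lattice_group set"
  assumes sdc: "super_dedekind_complete TYPE('r)"
    and "B \<noteq> {}" "bdd_below B"
  obtains B' where "B' \<subseteq> B" "B' \<noteq> {}" "countable B'" "Inf B' = Inf B"
proof -
  have Sup_uminus: "Sup (uminus ` D) = - Inf D" if "D \<noteq> {}" "bdd_below D" for D :: "'r set"
  proof (rule cSup_eq_non_empty)
    fix y assume "\<And>x. x \<in> uminus ` D \<Longrightarrow> x \<le> y"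
    then have "- y \<le> Inf D"
      using that by (intro cInf_greatest) (auto simp: minus_le_iff)
    then show "- Inf D \<le> y" by (simp add: minus_le_iff)
  qed (use that in \<open>auto intro: cInf_lower\<close>)
  have "bdd_above (uminus ` B)"
    using \<open>bdd_below B\<close> by (auto simp: bdd_below_def bdd_above_def)
      (metis neg_le_iff_le)
  then obtain A where A: "A \<subseteq> uminus ` B" "A \<noteq> {}" "countable A" "Sup A = Sup (uminus ` B)"
    using sdc \<open>B \<noteq> {}\<close> unfolding super_dedekind_complete_def by (metis image_is_empty)
  have sub: "uminus ` A \<subseteq> B" using A(1) by auto
  have "Sup (uminus ` (uminus ` A)) = - Inf (uminus ` A)"
    using A(2) bdd_below_mono[OF \<open>bdd_below B\<close> sub] by (intro Sup_uminus) auto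
  then have "Inf (uminus ` A) = Inf B"
    using A(4) Sup_uminus[OF assms(2,3)] by (simp add: image_image)
  then show ?thesis using that[of "uminus ` A"] sub A by auto
qed

text \<open>The suprema of the regulator along all \<open>\<phi>\<close> have infimum \<open>0\<close>, and countably many of them
  suffice for that. Finite infima of these form the wanted \<open>(O)\<close>-sequence, since being eventually
  below finitely many bounds is being eventually below their infimum.\<close>

lemma regulator_to_O_sequence:
  fixes a :: "nat \<Rightarrow> nat \<Rightarrow> 'r::dedekind_complete_lattice_group"
  assumes sdc: "super_dedekind_complete TYPE('r)"
    and wsd: "weakly_sigma_distributive TYPE('r)"
    and D: "D_sequence a"
  obtains s where "O_sequence s"
    "\<And>x k. D_lim a x 0 \<Longrightarrow> \<forall>\<^sub>F n in sequentially. \<bar>x n\<bar> \<le> s k"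
proof -
  define c where "c \<phi> = (SUP t. a t (\<phi> t))" for \<phi> :: "nat \<Rightarrow> nat"
  obtain u where u: "\<And>t l. \<bar>a t l\<bar> \<le> u"
    using D unfolding D_sequence_def by blast
  have nonneg: "0 \<le> a t l" for t l
  proof -
    have "bdd_below (range (a t))" "(INF l. a t l) = 0"
      using D unfolding D_sequence_def O_sequence_def by auto
    then show ?thesis by (metis cINF_lower UNIV_I)
  qed
  have bdd: "bdd_above (range (\<lambda>t. a t (\<phi> t)))" for \<phi>
    by (rule bdd_aboveI[of _ u]) (use u abs_ge_self order_trans in blast)
  have c_nonneg: "0 \<le> c \<phi>" for \<phi>
    unfolding c_def by (rule cSUP_upper2[OF bdd, of 0]) (use nonneg in auto)
  have bdd_c: "bdd_below (range c)"
    by (rule bdd_belowI[of _ 0]) (use c_nonneg in auto)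
  have Inf_c: "Inf (range c) = 0"
    using wsd D unfolding weakly_sigma_distributive_def c_def by blast
  obtain B where B: "B \<subseteq> range c" "B \<noteq> {}" "countable B" "Inf B = 0"
    using super_dedekind_complete_Inf[OF sdc _ bdd_c] Inf_c by auto
  define e where "e = from_nat_into B"
  have range_e: "range e = B" unfolding e_def using B by simp
  define s where "s k = (INF i\<in>{..k}. e i)" for k
  have bdd_e: "bdd_below (e ` X)" for X
    by (rule bdd_below_mono[OF bdd_c]) (use range_e B(1) in blast)
  have s_le: "s k \<le> e k" for k
    unfolding s_def by (rule cINF_lower[OF bdd_e]) simp
  have s_nonneg: "0 \<le> s k" for k
    unfolding s_def
  proof (rule cINF_greatest)
    fix i show "0 \<le> e i" using range_e B(1) c_nonneg by (metis imageE rangeI subsetD)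
  qed simp
  have bdd_s: "bdd_below (range s)"
    by (rule bdd_belowI[of _ 0]) (use s_nonneg in auto)
  have "decseq s"
    unfolding s_def by (auto simp: decseq_def intro!: cINF_superset_mono bdd_e)
  moreover have "(INF k. s k) = 0"
  proof (rule antisym)
    have "(INF k. s k) \<le> Inf B"
      unfolding range_e[symmetric]
      by (rule cINF_greatest) (auto intro: cINF_lower2[OF bdd_s _ s_le])
    then show "(INF k. s k) \<le> 0" using B by simp
    show "0 \<le> (INF k. s k)" by (rule cINF_greatest) (use s_nonneg in auto)
  qed
  ultimately have "O_sequence s" unfolding O_sequence_def using bdd_s by blast
  moreover have "\<forall>\<^sub>F n in sequentially. \<bar>x n\<bar> \<le> s k" if "D_lim a x 0" for x k
  proof -
    have "\<forall>\<^sub>F n in sequentially. \<bar>x n\<bar> \<le> e i" for i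
    proof -
      obtain \<phi> where "e i = c \<phi>" using range_e B(1) by blast
      then show ?thesis
        using that unfolding D_lim_def c_def by (simp add: eventually_sequentially)
    qed
    then have "\<forall>\<^sub>F n in sequentially. \<forall>i\<in>{..k}. \<bar>x n\<bar> \<le> e i"
      by (intro eventually_ball_finite) auto
    then show ?thesis
      unfolding s_def by eventually_elim (rule cINF_greatest, auto)
  qed
  ultimately show ?thesis using that by blast
qed

text \<open>An \<open>(O)\<close>-sequence is turned back into a regulator by repeating it in every row: the supremum
  along \<open>\<phi>\<close> dominates the entry \<open>s (\<phi> 0)\<close>.\<close>

lemma O_sequence_imp_D_sequence_const:
  fixes s :: "nat \<Rightarrow> 'r::dedekind_complete_lattice_group"
  assumes "O_sequence s"
  shows "D_sequence (\<lambda>t. s)"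
    and "(\<And>k. \<forall>\<^sub>F n in sequentially. \<bar>x n\<bar> \<le> s k) \<Longrightarrow> D_lim (\<lambda>t. s) x 0"
proof -
  have nonneg: "0 \<le> s k" and le: "s k \<le> s 0" for k
    using assms unfolding O_sequence_def decseq_def by (metis cINF_lower UNIV_I, simp)
  then show "D_sequence (\<lambda>t. s)"
    using assms unfolding D_sequence_def by auto
  assume *: "\<And>k. \<forall>\<^sub>F n in sequentially. \<bar>x n\<bar> \<le> s k"
  show "D_lim (\<lambda>t. s) x 0"
    unfolding D_lim_def
  proof
    fix \<phi> :: "nat \<Rightarrow> nat"
    have "s (\<phi> 0) \<le> (SUP t. s (\<phi> t))"
      by (rule cSUP_upper) (auto intro!: bdd_aboveI[of _ "s 0"] le)
    with *[of "\<phi> 0"] show "\<exists>n0. \<forall>n\<ge>n0. \<bar>x n - 0\<bar> \<le> (SUP t. s (\<phi> t))"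
      by (auto simp: eventually_sequentially intro: order_trans)
  qed
qed

section \<open>Thinning out a disjoint sequence\<close>

lemma strict_mono_prod_encode: "strict_mono (\<lambda>k. prod_encode (i, k))"
  by (simp add: strict_mono_Suc_iff prod_encode_def)

text \<open>The pairing function splits the indices of \<open>C\<close> into infinitely many disjoint infinite sets.
  If each of them had a union violating the bound, these unions would be a disjoint sequence.\<close>

lemma s_bounded_bound_subsequence:
  fixes C :: "nat \<Rightarrow> 'a set" and \<mu> :: "'a set \<Rightarrow> 'r::dedekind_complete_lattice_group"
  assumes disj: "disjoint_family C"
    and L: "\<And>I. (\<Union>i\<in>I. C i) \<in> L"
    and bound: "\<And>D. disjoint_sequence_in L D \<Longrightarrow> \<forall>\<^sub>F n in sequentially. \<mu> (D n) \<le> b"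
  shows "\<exists>r :: nat \<Rightarrow> nat. strict_mono r \<and> (\<forall>I. \<mu> (\<Union>i\<in>I. C (r i)) \<le> b)"
proof (rule ccontr)
  assume "\<not> ?thesis"
  then have "\<forall>j. \<exists>I. \<not> \<mu> (\<Union>i\<in>I. C (prod_encode (j, i))) \<le> b"
    using strict_mono_prod_encode by blast
  then obtain I where I: "\<And>j. \<not> \<mu> (\<Union>i\<in>I j. C (prod_encode (j, i))) \<le> b" by metis
  define D where "D j = (\<Union>i\<in>I j. C (prod_encode (j, i)))" for j
  have "D j \<in> L" for j
    using L[of "(\<lambda>i. prod_encode (j, i)) ` I j"] unfolding D_def by simp
  moreover have "disjoint_family D"
    unfolding disjoint_family_on_def
  proof (intro ballI impI)
    fix j k :: nat assume "j \<noteq> k"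
    then have "C (prod_encode (j, i)) \<inter> C (prod_encode (k, i')) = {}" for i i'
      using disj by (simp add: disjoint_family_on_def)
    then show "D j \<inter> D k = {}" unfolding D_def by blast
  qed
  ultimately have "disjoint_sequence_in L D"
    unfolding disjoint_sequence_in_def by blast
  from bound[OF this] show False
    using I unfolding D_def by (auto simp: eventually_sequentially)
qed

section \<open>Continuity from above along a diagonal subsequence\<close>

theorem theorem3p9:
  fixes G :: "'a set"
    and L :: "'a set set"
    and m :: "nat \<Rightarrow> 'a set \<Rightarrow> 'r::dedekind_complete_lattice_group"
    and C :: "nat \<Rightarrow> 'a set"
  assumes "super_dedekind_complete TYPE('r)"
    and "weakly_sigma_distributive TYPE('r)"
    and "infinite G"
    and "algebra G L"
    and "property_E L"
    and "equibounded_on L m"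
    and "\<And>j. positive_on L (m j)"
    and "\<And>j. s_bounded_on L (m j)"
    and "disjoint_sequence_in L C"
  shows "\<exists>n :: nat \<Rightarrow> nat. strict_mono n \<and>
    sigma_sets (\<Union>h. C (n h)) (range (\<lambda>h. C (n h))) \<subseteq> L \<and>
    (\<forall>j. continuous_from_above_at_empty_on
      (sigma_sets (\<Union>h. C (n h)) (range (\<lambda>h. C (n h)))) (m j))"
proof -
  obtain r :: "nat \<Rightarrow> nat" where r: "strict_mono r"
    and rL: "sigma_sets (\<Union>i. C (r i)) (range (\<lambda>i. C (r i))) \<subseteq> L"
    using assms(5,9) unfolding property_E_def by blast
  define E where "E i = C (r i)" for i
  have disj: "disjoint_family (\<lambda>i. E (q i))" if "strict_mono q" for q :: "nat \<Rightarrow> nat"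
    unfolding disjoint_family_on_def
  proof (intro ballI impI)
    fix i k :: nat assume "i \<noteq> k"
    then have "r (q i) \<noteq> r (q k)"
      using injD[OF strict_mono_imp_inj_on[OF strict_mono_o[OF r that]], of i k] by auto
    then show "E (q i) \<inter> E (q k) = {}"
      using assms(9) unfolding E_def disjoint_sequence_in_def disjoint_family_on_def by simp
  qed
  have EL: "(\<Union>i\<in>I. E (q i)) \<in> L" for I and q :: "nat \<Rightarrow> nat"
    using UN_in_sigma_sets_range[of E "q ` I"] rL unfolding E_def by auto
  have "\<exists>s. O_sequence s \<and> (\<forall>D k. disjoint_sequence_in L D \<longrightarrow>
      (\<forall>\<^sub>F n in sequentially. m j (D n) \<le> s k))" for j
  proof -
    obtain a where a: "D_sequence a"
      "\<And>D. disjoint_sequence_in L D \<Longrightarrow> D_lim a (\<lambda>h. m j (D h)) 0"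
      using assms(8)[of j] unfolding s_bounded_on_def by blast
    obtain s where s: "O_sequence s"
      "\<And>x k. D_lim a x 0 \<Longrightarrow> \<forall>\<^sub>F n in sequentially. \<bar>x n\<bar> \<le> s k"
      using regulator_to_O_sequence[OF assms(1,2) a(1)] by blast
    have "\<forall>\<^sub>F n in sequentially. m j (D n) \<le> s k" if "disjoint_sequence_in L D" for D k
      using s(2)[OF a(2)[OF that], of k]
      by eventually_elim (use abs_ge_self order_trans in blast)
    with s(1) show ?thesis by blast
  qed
  then obtain s where s: "\<And>j. O_sequence (s j)"
    and bound: "\<And>j D k. disjoint_sequence_in L D \<Longrightarrow>
      \<forall>\<^sub>F n in sequentially. m j (D n) \<le> s j k"
    by metis
  (* P p q: for the pair (j, k) coded by p, the bound s j k holds on all unions along q. *)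
  define P where "P p q \<longleftrightarrow> (\<forall>I. m (fst (prod_decode p)) (\<Union>i\<in>I. E (q i))
      \<le> s (fst (prod_decode p)) (snd (prod_decode p)))" for p and q :: "nat \<Rightarrow> nat"
  interpret subseqs P
  proof
    fix p and q :: "nat \<Rightarrow> nat" assume "strict_mono q"
    define j k where "j = fst (prod_decode p)" and "k = snd (prod_decode p)"
    have "\<exists>r' :: nat \<Rightarrow> nat. strict_mono r' \<and> (\<forall>I. m j (\<Union>i\<in>I. E (q (r' i))) \<le> s j k)"
      by (rule s_bounded_bound_subsequence[where C = "\<lambda>i. E (q i)",
            OF disj[OF \<open>strict_mono q\<close>] EL bound])
    then show "\<exists>r'. strict_mono r' \<and> P p (q \<circ> r')"
      unfolding P_def j_def k_def by simp
  qed
  have tail: "P p (diagseq \<circ> ((+) (Suc p)))" for p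
  proof (rule diagseq_holds)
    fix p and q q' :: "nat \<Rightarrow> nat" assume "P p q"
    show "P p (q \<circ> q')"
      unfolding P_def
    proof
      fix I
      show "m (fst (prod_decode p)) (\<Union>i\<in>I. E ((q \<circ> q') i))
          \<le> s (fst (prod_decode p)) (snd (prod_decode p))"
        using \<open>P p q\<close>[unfolded P_def, rule_format, of "q' ` I"] by simp
    qed
  qed
  define n where "n = r \<circ> diagseq"
  have Cn: "C (n h) = E (diagseq h)" for h by (simp add: n_def E_def)
  let ?S = "sigma_sets (\<Union>h. E (diagseq h)) (range (\<lambda>h. E (diagseq h)))"
  note disj_diag = disj[OF subseq_diagseq]
  have sub: "?S \<subseteq> L"
    unfolding sigma_sets_disjoint_family_eq[OF disj_diag] using EL by blast
  have "continuous_from_above_at_empty_on ?S (m j)" for j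
    unfolding continuous_from_above_at_empty_on_def
  proof (intro exI conjI allI impI)
    show "D_sequence (\<lambda>t. s j)" using s by (rule O_sequence_imp_D_sequence_const)
    fix H assume H: "range H \<subseteq> ?S \<and> decseq H \<and> (\<Inter>n. H n) = {}"
    show "D_lim (\<lambda>t. s j) (\<lambda>n. m j (H n)) 0"
    proof (rule O_sequence_imp_D_sequence_const(2)[OF s])
      fix k
      (* the pair coded by p is dealt with from diagonal position Suc p on *)
      let ?p = "Suc (prod_encode (j, k))"
      have "\<forall>\<^sub>F n in sequentially. \<exists>I. H n = (\<Union>i\<in>I. E (diagseq (?p + i)))"
        by (rule decseq_to_empty_eventually_in_tail[OF disj_diag]) (use H in auto)
      then show "\<forall>\<^sub>F n in sequentially. \<bar>m j (H n)\<bar> \<le> s j k"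
      proof eventually_elim
        case (elim n)
        then have "m j (H n) \<le> s j k"
          using tail[of "prod_encode (j, k)"] unfolding P_def by auto
        moreover have "0 \<le> m j (H n)"
          using assms(7)[of j] H sub unfolding positive_on_def by blast
        ultimately show ?case by simp
      qed
    qed
  qed
  moreover have "strict_mono n"
    unfolding n_def using r subseq_diagseq by (rule strict_mono_o)
  ultimately show ?thesis using sub unfolding Cn[symmetric] by blast
qed

end
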